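(* Let $K$ be a field of characteristic $0$, let $n\geq 1$, and let $F=(F_1,\dots,F_n):K^n\to K^n$ be a polynomial map of the form $F_i(X_1,\dots,X_n)=X_i+H_i(X_1,\dots,X_n)$, $1\leq i\leq n$, where $H_i(X_1,\dots,X_n)=L_i(X_1,\dots,X_n)^3$ and $L_i(X_1,\dots,X_n)=a_{i1}X_1+\dots+a_{in}X_n$ with $a_{ij}\in K$. Let $JH=\left(\frac{\partial H_i}{\partial X_j}\right)_{1\leq i,j\leq n}$ denote the Jacobian matrix of $H:=(H_1,\dots,H_n)$, a matrix over $K[X_1,\dots,X_n]$. 1) If $(JH)^2=0$, then $F$ is nice. Moreover $F^{-1}=X-H$, i.e. $F$ is invertible and the $i$-th component of $F^{-1}$ is $X_i-H_i(X_1,\dots,X_n)$ for $1\leq i\leq n$. 2) If $(JH)^3=0$, then $F$ is nice. Moreover $F$ is invertible and $F^{-1}$ has degree at most $9$.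
   Context: $K$ is a field of characteristic $0$. A polynomial map $F=(F_1,\dots,F_n):K^n\to K^n$ is a map whose components $F_i$ are in the polynomial ring $K[X_1,\dots,X_n]$; it is invertible if it has an inverse $F^{-1}$ which is a polynomial map. The degree of $F$ is $\deg F=\max\{\deg F_i: 1\leq i\leq n\}$. Given a polynomial map $F$, define for $i=1,\dots,n$ the polynomials $P_0^i=X_i$ and, for $k\geq 1$, $P_k^i(X_1,\dots,X_n)=P_{k-1}^i(F_1,\dots,F_n)-P_{k-1}^i(X_1,\dots,X_n)$ (so $P_1^i=F_i-X_i$). The map $F$ is called nice if there exists an integer $m$ such that $P_m^i=0$ for all $i=1,\dots,n$. *)

theory Defs
  imports "HOL-Analysis.Analysis" "HOL-Library.Poly_Mapping"
begin

text \<open>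
  The polynomial ring \<open>K[X\<^sub>i | i \<in> 'n]\<close> is the monoid algebra of exponent
  vectors \<open>'n \<Rightarrow>\<^sub>0 nat\<close> over \<open>'a\<close>, with the ring structure (convolution product)
  that the library provides for finitely supported functions.  Its elements are formal
  polynomials.
\<close>

type_synonym ('a, 'n) mpoly = "('n \<Rightarrow>\<^sub>0 nat) \<Rightarrow>\<^sub>0 'a"

definition Const :: "'a::comm_ring_1 \<Rightarrow> ('a, 'n) mpoly"
  where "Const c = Poly_Mapping.single 0 c"

definition Var :: "'n \<Rightarrow> ('a::comm_ring_1, 'n) mpoly"
  where "Var i = Poly_Mapping.single (Poly_Mapping.single i 1) 1"

text \<open>The degree of the zero polynomial is \<open>0\<close> by convention.\<close>

definition total_degree :: "('a::comm_ring_1, 'n::finite) mpoly \<Rightarrow> nat"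
  where "total_degree p =
    Max (insert 0 ((\<lambda>m. \<Sum>i\<in>UNIV. Poly_Mapping.lookup m i) ` Poly_Mapping.keys p))"

text \<open>
  If \<open>m\<close> does not contain \<open>X\<^sub>j\<close>, the subtraction of exponents is truncated, but then the
  coefficient \<open>of_nat (lookup m j)\<close> is \<open>0\<close>.
\<close>

definition partial_deriv :: "'n \<Rightarrow> ('a::comm_ring_1, 'n) mpoly \<Rightarrow> ('a, 'n) mpoly"
  where "partial_deriv j p =
    (\<Sum>m\<in>Poly_Mapping.keys p.
      Poly_Mapping.single (m - Poly_Mapping.single j 1)
        (of_nat (Poly_Mapping.lookup m j) * Poly_Mapping.lookup p m))"

text \<open>
  A polynomial map \<open>K\<^sup>n \<rightarrow> K\<^sup>n\<close> is given by the vector of its components, where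
  \<open>n = CARD('n)\<close>; composition of polynomial maps is substitution.
\<close>

type_synonym ('a, 'n) poly_map = "('a, 'n) mpoly ^ 'n"

definition poly_subst ::
    "('a::comm_ring_1, 'n::finite) poly_map \<Rightarrow> ('a, 'n) mpoly \<Rightarrow> ('a, 'n) mpoly"
  where "poly_subst F p =
    (\<Sum>m\<in>Poly_Mapping.keys p.
      Const (Poly_Mapping.lookup p m) * (\<Prod>i\<in>UNIV. (F $ i) ^ Poly_Mapping.lookup m i))"

definition poly_map_id :: "('a::comm_ring_1, 'n::finite) poly_map"
  where "poly_map_id = (\<chi> i. Var i)"

definition poly_map_comp ::
    "('a::comm_ring_1, 'n::finite) poly_map \<Rightarrow> ('a, 'n) poly_map \<Rightarrow> ('a, 'n) poly_map"
  where "poly_map_comp G F = (\<chi> i. poly_subst F (G $ i))"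

definition is_poly_map_inverse ::
    "('a::comm_ring_1, 'n::finite) poly_map \<Rightarrow> ('a, 'n) poly_map \<Rightarrow> bool"
  where "is_poly_map_inverse F G \<longleftrightarrow>
    poly_map_comp F G = poly_map_id \<and> poly_map_comp G F = poly_map_id"

definition poly_map_invertible :: "('a::comm_ring_1, 'n::finite) poly_map \<Rightarrow> bool"
  where "poly_map_invertible F \<longleftrightarrow> (\<exists>G. is_poly_map_inverse F G)"

definition poly_map_inv :: "('a::comm_ring_1, 'n::finite) poly_map \<Rightarrow> ('a, 'n) poly_map"
  where "poly_map_inv F = (THE G. is_poly_map_inverse F G)"

definition poly_map_degree :: "('a::comm_ring_1, 'n::finite) poly_map \<Rightarrow> nat"
  where "poly_map_degree F = Max (range (\<lambda>i. total_degree (F $ i)))"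

definition jacobian_matrix :: "('a::comm_ring_1, 'n::finite) poly_map \<Rightarrow> ('a, 'n) mpoly ^ 'n ^ 'n"
  where "jacobian_matrix H = (\<chi> i j. partial_deriv j (H $ i))"

primrec nice_seq ::
    "('a::comm_ring_1, 'n::finite) poly_map \<Rightarrow> nat \<Rightarrow> 'n \<Rightarrow> ('a, 'n) mpoly"
  where
    "nice_seq F 0 i = Var i"
  | "nice_seq F (Suc k) i = poly_subst F (nice_seq F k i) - nice_seq F k i"

definition nice :: "('a::comm_ring_1, 'n::finite) poly_map \<Rightarrow> bool"
  where "nice F \<longleftrightarrow> (\<exists>m. \<forall>i. nice_seq F m i = 0)"

end

theory Submission
  imports Defs
begin

text \<open>
  Put \<open>M\<^sub>i = \<Sum>\<^sub>j a\<^sub>i\<^sub>j L\<^sub>j\<^sup>3\<close>, so that \<open>L\<^sub>i \<circ> F = L\<^sub>i + M\<^sub>i\<close>.  Since \<open>JH = 3 diag(L\<^sup>2) a\<close>, cancelling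
  the leftmost factor \<open>L\<^sub>i\<^sup>2\<close> from \<open>(JH)\<^sup>3 = 0\<close> leaves an identity whose contraction with \<open>X\<close> is
  \<open>\<Sum>\<^sub>j a\<^sub>i\<^sub>j L\<^sub>j\<^sup>2 M\<^sub>j = 0\<close>.  Differentiating once and twice, and contracting with \<open>H\<close>,
  gives \<open>\<Sum>\<^sub>j a\<^sub>i\<^sub>j L\<^sub>j M\<^sub>j\<^sup>2 = 0\<close> and \<open>\<Sum>\<^sub>j a\<^sub>i\<^sub>j M\<^sub>j\<^sup>3 = 0\<close>.  Hence \<open>M \<circ> F = M\<close>, the inverse is
  \<open>X - (L - M)\<^sup>3\<close>, and \<open>F\<close> is nice because \<open>P\<^sub>1 = L\<^sup>3\<close> is a cubic in \<open>L\<close> of which finite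
  differences with step \<open>M\<close> are taken.  If \<open>(JH)\<^sup>2 = 0\<close>, the same cancellation gives \<open>M = 0\<close>.
\<close>

text \<open>Each update at a fresh key adds a monomial, and \<open>0\<close> is a monomial with
  coefficient \<open>0\<close>. Identities additive in the polynomial thus need checking on
  monomials only.\<close>

lemma poly_mapping_single_add_induct [case_names single add]:
  fixes p :: "'k \<Rightarrow>\<^sub>0 'c::comm_monoid_add"
  assumes single: "\<And>m c. P (Poly_Mapping.single m c)"
    and add: "\<And>p q. P p \<Longrightarrow> P q \<Longrightarrow> P (p + q)"
  shows "P p"
proof (induction p rule: update_induct)
  case const
  show ?case using single[of undefined 0] by simp
next
  case (update f m c)
  have "Poly_Mapping.update m c f = f + Poly_Mapping.single m c"
    using update(1)
    by (intro poly_mapping_eqI)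
      (auto simp: lookup_update lookup_add lookup_single when_def in_keys_iff)
  then show ?case using add[OF update(3) single] by simp
qed

subsection \<open>Substitution\<close>

lemma Const_mult: "Const (c * d) = Const c * Const d"
  by (simp add: Const_def mult_single)

lemma Const_of_nat: "Const (of_nat k) = of_nat k"
  by (simp add: Const_def)

lemma Const_1 [simp]: "Const 1 = 1"
  by (simp add: Const_def)

lemma Const_numeral: "Const (numeral w) = numeral w"
  by (simp add: Const_def)

lemma Const_mult_eq_0_iff:
  fixes c :: "'a::field"
  assumes "c \<noteq> 0"
  shows "Const c * q = 0 \<longleftrightarrow> q = 0"
proof
  assume "Const c * q = 0"
  then have "Const (inverse c * c) * q = 0"
    by (simp only: Const_mult mult.assoc mult_zero_right)
  then show "q = 0" using assms by simp
qed simp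

lemma numeral_mult_eq_0_iff:
  fixes q :: "('a::field_char_0, 'n) mpoly"
  shows "numeral w * q = 0 \<longleftrightarrow> q = 0"
  using Const_mult_eq_0_iff[of "numeral w :: 'a" q] by (simp add: Const_numeral)

lemma poly_subst_add: "poly_subst F (p + q) = poly_subst F p + poly_subst F q"
  unfolding poly_subst_def
  by (rule setsum_keys_plus_distrib) (simp_all add: Const_def single_add distrib_right)

lemma poly_subst_single:
  "poly_subst F (Poly_Mapping.single m c) =
    Const c * (\<Prod>i\<in>UNIV. (F $ i) ^ Poly_Mapping.lookup m i)"
  by (cases "c = 0") (simp_all add: poly_subst_def Const_def)

lemma poly_subst_0 [simp]: "poly_subst F 0 = 0"
  by (simp add: poly_subst_def)

lemma poly_subst_mult: "poly_subst F (p * q) = poly_subst F p * poly_subst F q"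
proof (induction p rule: poly_mapping_single_add_induct)
  case (single m c)
  show ?case
  proof (induction q rule: poly_mapping_single_add_induct)
    case (single k d)
    show ?case
      by (simp add: mult_single poly_subst_single lookup_add power_add prod.distrib Const_mult mult_ac)
  qed (simp add: poly_subst_add distrib_left)
qed (simp add: poly_subst_add distrib_right)

lemma poly_subst_Const [simp]: "poly_subst F (Const c) = Const c"
  unfolding Const_def[of c] poly_subst_single by (simp add: Const_def)

lemma poly_subst_Var [simp]: "poly_subst F (Var i) = F $ i"
proof -
  have "(\<Prod>k\<in>UNIV. (F $ k) ^ Poly_Mapping.lookup (Poly_Mapping.single i 1) k) =
      (\<Prod>k\<in>UNIV. if k = i then F $ k else 1)"
    by (intro prod.cong) (auto simp: lookup_single when_def)
  then show ?thesis
    by (simp add: Var_def poly_subst_single Const_def)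
qed

lemma poly_subst_1 [simp]: "poly_subst F 1 = 1"
  using poly_subst_Const[of F 1] by simp

lemma poly_subst_numeral: "poly_subst F (numeral w) = numeral w"
  by (metis Const_numeral poly_subst_Const)

lemma poly_subst_diff: "poly_subst F (p - q) = poly_subst F p - poly_subst F q"
  using poly_subst_add[of F "p - q" q] by simp

lemma poly_subst_power: "poly_subst F (p ^ k) = poly_subst F p ^ k"
  by (induction k) (simp_all add: poly_subst_mult)

lemma poly_subst_sum: "poly_subst F (sum f S) = (\<Sum>x\<in>S. poly_subst F (f x))"
  by (induction S rule: infinite_finite_induct) (simp_all add: poly_subst_add)

lemma poly_subst_prod: "poly_subst F (prod f S) = (\<Prod>x\<in>S. poly_subst F (f x))"
  by (induction S rule: infinite_finite_induct) (simp_all add: poly_subst_mult)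

lemma poly_subst_subst:
  "poly_subst F (poly_subst G p) = poly_subst (poly_map_comp G F) p"
  by (induction p rule: poly_mapping_single_add_induct)
    (simp_all add: poly_subst_add poly_subst_single poly_subst_mult poly_subst_prod
      poly_subst_power poly_map_comp_def)

lemma prod_Var_power:
  "(\<Prod>i\<in>S. Var i ^ f i) =
    (Poly_Mapping.single (\<Sum>i\<in>S. Poly_Mapping.single i (f i)) 1 :: ('a::comm_ring_1, 'n) mpoly)"
proof -
  have pow: "Var i ^ k = (Poly_Mapping.single (Poly_Mapping.single i k) 1 :: ('a, 'n) mpoly)"
    for i k
    by (induction k) (simp_all add: Var_def mult_single flip: single_add)
  show ?thesis
    by (induction S rule: infinite_finite_induct) (simp_all add: pow mult_single)
qed

lemma poly_subst_id [simp]: "poly_subst poly_map_id p = p"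
proof (induction p rule: poly_mapping_single_add_induct)
  case (single m c)
  have "(\<Sum>i\<in>UNIV. Poly_Mapping.single i (Poly_Mapping.lookup m i)) = m"
    by (intro poly_mapping_eqI) (simp add: lookup_sum lookup_single when_def)
  then show ?case
    by (simp add: poly_subst_single poly_map_id_def prod_Var_power Const_def mult_single)
qed (simp add: poly_subst_add)

subsection \<open>Composition and inverses of polynomial maps\<close>

lemma poly_map_comp_assoc:
  "poly_map_comp (poly_map_comp F G) H = poly_map_comp F (poly_map_comp G H)"
  by (simp add: vec_eq_iff poly_map_comp_def[of _ H] poly_map_comp_def[of F] poly_subst_subst)

lemma poly_map_comp_id [simp]:
  "poly_map_comp F poly_map_id = F" "poly_map_comp poly_map_id F = F"
  by (simp_all add: vec_eq_iff poly_map_comp_def) (simp add: poly_map_id_def)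

text \<open>Two-sided inverses in a monoid are unique, so the definite description in
  \<open>poly_map_inv\<close> picks \<open>G\<close>.\<close>

lemma poly_map_inv_eqI:
  assumes "is_poly_map_inverse F G"
  shows "poly_map_inv F = G"
  unfolding poly_map_inv_def
proof (rule the_equality[where P = "is_poly_map_inverse F", OF assms])
  fix G' assume "is_poly_map_inverse F G'"
  then have "G' = poly_map_comp (poly_map_comp G F) G'"
    using assms by (simp add: is_poly_map_inverse_def)
  also have "\<dots> = G"
    unfolding poly_map_comp_assoc
    using \<open>is_poly_map_inverse F G'\<close> by (simp add: is_poly_map_inverse_def)
  finally show "G' = G" .
qed

subsection \<open>Partial derivatives\<close>

lemma partial_deriv_add:
  "partial_deriv j (p + q) = partial_deriv j p + partial_deriv j q"
  unfolding partial_deriv_def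
  by (rule setsum_keys_plus_distrib) (simp_all add: distrib_left single_add)

lemma partial_deriv_single:
  "partial_deriv j (Poly_Mapping.single m c) =
    Poly_Mapping.single (m - Poly_Mapping.single j 1) (of_nat (Poly_Mapping.lookup m j) * c)"
  by (cases "c = 0") (simp_all add: partial_deriv_def)

lemma partial_deriv_0 [simp]: "partial_deriv j 0 = 0"
  by (simp add: partial_deriv_def)

lemma partial_deriv_sum: "partial_deriv j (sum f S) = (\<Sum>x\<in>S. partial_deriv j (f x))"
  by (induction S rule: infinite_finite_induct) (simp_all add: partial_deriv_add)

lemma partial_deriv_Const [simp]: "partial_deriv j (Const c) = 0"
  unfolding Const_def partial_deriv_single by simp

lemma partial_deriv_Var: "partial_deriv j (Var i) = (if i = j then 1 else 0)"
  unfolding Var_def partial_deriv_single by (auto simp: lookup_single)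

text \<open>The truncated subtractions can differ only where \<open>m\<close> lacks the variable
  \<open>j\<close>, and there both coefficients are \<open>0\<close>. This is one half of the
  product rule on monomials.\<close>

lemma partial_deriv_single_mult:
  "Poly_Mapping.single (m + k - Poly_Mapping.single j 1) (of_nat (Poly_Mapping.lookup m j) * c) =
    Poly_Mapping.single (m - Poly_Mapping.single j 1 + k)
      (of_nat (Poly_Mapping.lookup m j) * (c::'a::comm_ring_1))"
proof (cases "Poly_Mapping.lookup m j = 0")
  case False
  then have "m + k - Poly_Mapping.single j 1 = m - Poly_Mapping.single j 1 + k"
    by (intro poly_mapping_eqI) (auto simp: lookup_add lookup_minus lookup_single when_def)
  then show ?thesis by simp
qed simp

lemma partial_deriv_mult:
  "partial_deriv j (p * q) = partial_deriv j p * q + p * partial_deriv j q"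
proof (induction p rule: poly_mapping_single_add_induct)
  case (single m c)
  show ?case
  proof (induction q rule: poly_mapping_single_add_induct)
    case (single k d)
    show ?case
      using partial_deriv_single_mult[of m k j "c * d"] partial_deriv_single_mult[of k m j "c * d"]
      by (simp add: mult_single partial_deriv_single lookup_add single_add algebra_simps)
  qed (simp add: partial_deriv_add algebra_simps)
qed (simp add: partial_deriv_add algebra_simps)

text \<open>Each derivative lowers the exponent of the variable \<open>j\<close>, so one derivative
  more than that exponent kills a monomial; for a sum the two orders are added.\<close>

lemma partial_deriv_nilpotent: "\<exists>k. (partial_deriv j ^^ k) p = 0"
proof (induction p rule: poly_mapping_single_add_induct)
  case (single m c)
  have "(partial_deriv j ^^ Suc (Poly_Mapping.lookup m j)) (Poly_Mapping.single m c) = 0"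
  proof (induction "Poly_Mapping.lookup m j" arbitrary: m c)
    case 0
    then show ?case by (simp add: partial_deriv_single)
  next
    case (Suc k)
    then have "k = Poly_Mapping.lookup (m - Poly_Mapping.single j 1) j"
      by (simp add: lookup_minus lookup_single)
    from Suc(1)[OF this] this Suc(2)[symmetric] show ?case
      by (simp add: funpow_Suc_right partial_deriv_single del: funpow.simps)
  qed
  then show ?case ..
next
  case (add p q)
  then obtain k l where "(partial_deriv j ^^ k) p = 0" "(partial_deriv j ^^ l) q = 0"
    by blast
  moreover have "(partial_deriv j ^^ n) 0 = 0" for n
    by (induction n) auto
  moreover have "(partial_deriv j ^^ n) (p + q) =
      (partial_deriv j ^^ n) p + (partial_deriv j ^^ n) q" for n
    by (induction n) (auto simp: partial_deriv_add)
  ultimately have "(partial_deriv j ^^ (l + k)) p = 0" "(partial_deriv j ^^ (k + l)) q = 0"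
    and "(partial_deriv j ^^ (k + l)) (p + q) =
      (partial_deriv j ^^ (k + l)) p + (partial_deriv j ^^ (k + l)) q"
    by (simp_all add: funpow_add)
  then have "(partial_deriv j ^^ (k + l)) (p + q) = 0"
    by (simp add: add.commute)
  then show ?case ..
qed

text \<open>
  The exponent monoid carries no linear order here, so the library does not provide
  that the polynomial ring is a domain.  Applying \<open>\<partial>\<^sub>j\<close> sufficiently often to \<open>l * q = 0\<close>
  lowers the order of nilpotency of \<open>\<partial>\<^sub>j\<close> at \<open>q\<close> down to \<open>0\<close>.
\<close>

lemma mult_eq_0_if_const_deriv:
  fixes l q :: "('a::field_char_0, 'n) mpoly"
  assumes l: "partial_deriv j l = Const c" "c \<noteq> 0" and lq: "l * q = 0"
  shows "q = 0"
proof -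
  let ?D = "\<lambda>k. partial_deriv j ^^ k"
  \<comment> \<open>The second derivative of \<open>l\<close> is \<open>0\<close>, so only two terms
    of the Leibniz formula survive.\<close>
  have leibniz: "?D (Suc k) (l * q) = l * ?D (Suc k) q + of_nat (Suc k) * Const c * ?D k q" for k
  proof (induction k)
    case (Suc k)
    have "partial_deriv j (of_nat n :: ('a, 'n) mpoly) = 0" for n
      by (metis Const_of_nat partial_deriv_Const)
    with Suc show ?case
      using l(1) by (simp add: partial_deriv_add partial_deriv_mult algebra_simps)
  qed (use l(1) in \<open>simp add: partial_deriv_mult\<close>)
  have "?D k (0 :: ('a, 'n) mpoly) = 0" for k
    by (induction k) auto
  then have D: "l * ?D (Suc k) q + of_nat (Suc k) * Const c * ?D k q = 0" for k
    using leibniz[of k] lq by simp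
  \<comment> \<open>Characteristic \<open>0\<close> makes \<open>of_nat (Suc k) * c\<close>
    invertible, so the vanishing descends by one order.\<close>
  have step: "?D k q = 0" if "?D (Suc k) q = 0" for k
  proof -
    have "Const (of_nat (Suc k) * c) * ?D k q = 0"
      using D[of k] that by (simp only: mult_zero_right add_0 Const_mult Const_of_nat)
    moreover have "of_nat (Suc k) * c \<noteq> 0"
      using \<open>c \<noteq> 0\<close> by (simp del: of_nat_Suc)
    ultimately show ?thesis
      by (rule Const_mult_eq_0_iff[THEN iffD1, rotated])
  qed
  obtain k where "?D k q = 0"
    using partial_deriv_nilpotent[of j q] by blast
  then show ?thesis
    by (induction k) (use step in auto)
qed

subsection \<open>Total degree\<close>

lemma total_degree_le_iff:
  "total_degree p \<le> d \<longleftrightarrow>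
    (\<forall>m\<in>Poly_Mapping.keys p. (\<Sum>i\<in>UNIV. Poly_Mapping.lookup m i) \<le> d)"
  by (auto simp: total_degree_def)

lemma total_degree_add:
  assumes "total_degree p \<le> d" "total_degree q \<le> d"
  shows "total_degree (p + q) \<le> d"
  using assms keys_add[of p q] unfolding total_degree_le_iff by blast

lemma total_degree_diff:
  assumes "total_degree p \<le> d" "total_degree q \<le> d"
  shows "total_degree (p - q) \<le> d"
  using assms keys_diff[of p q] unfolding total_degree_le_iff
  by (metis (no_types) UnE subset_iff)

lemma total_degree_mult:
  assumes "total_degree p \<le> d" "total_degree q \<le> e"
  shows "total_degree (p * q) \<le> d + e"
  unfolding total_degree_le_iff
proof
  fix m assume "m \<in> Poly_Mapping.keys (p * q)"
  then obtain u v where "u \<in> Poly_Mapping.keys p" "v \<in> Poly_Mapping.keys q" "m = u + v"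
    using keys_mult[of p q] by blast
  then show "(\<Sum>i\<in>UNIV. Poly_Mapping.lookup m i) \<le> d + e"
    using assms by (simp add: total_degree_le_iff lookup_add sum.distrib add_mono)
qed

lemma total_degree_Const: "total_degree (Const c) = 0"
  by (simp add: total_degree_def Const_def)

lemma total_degree_Var: "total_degree (Var i) \<le> 1"
  by (simp add: total_degree_le_iff Var_def lookup_single when_def)

lemma total_degree_power:
  assumes "total_degree p \<le> d"
  shows "total_degree (p ^ k) \<le> k * d"
proof (induction k)
  case 0
  show ?case using total_degree_Const[of 1] by simp
next
  case (Suc k)
  show ?case using total_degree_mult[OF assms Suc] by simp
qed

lemma total_degree_sum:
  assumes "\<And>x. x \<in> S \<Longrightarrow> total_degree (f x) \<le> d"
  shows "total_degree (sum f S) \<le> d"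
  using assms
proof (induction S rule: infinite_finite_induct)
  case (insert x S)
  then show ?case by (simp add: total_degree_add)
qed (simp_all add: total_degree_def)

subsection \<open>Maps of cubic linear type\<close>

locale cubic_linear_map =
  fixes a :: "'a::field_char_0 ^ 'n::finite ^ 'n"
    and L H F :: "('a, 'n) poly_map"
  assumes L: "\<And>i. L $ i = (\<Sum>j\<in>UNIV. Const (a $ i $ j) * Var j)"
    and H: "\<And>i. H $ i = (L $ i) ^ 3"
    and F: "\<And>i. F $ i = Var i + H $ i"
begin

abbreviation A :: "'n \<Rightarrow> 'n \<Rightarrow> ('a, 'n) mpoly"
  where "A i j \<equiv> Const (a $ i $ j)"

definition M :: "'n \<Rightarrow> ('a, 'n) mpoly"
  where "M i = (\<Sum>j\<in>UNIV. A i j * H $ j)"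

text \<open>The matrix \<open>a diag(L^2) a\<close>: a third of the Jacobian matrix of
  \<open>M\<close>, and what remains of a ninth of \<open>(JH)^2\<close> once row \<open>i\<close>
  loses its factor \<open>L_i^2\<close>.\<close>

definition N :: "'n \<Rightarrow> 'n \<Rightarrow> ('a, 'n) mpoly"
  where "N i p = (\<Sum>j\<in>UNIV. A i j * (L $ j)\<^sup>2 * A j p)"

lemma partial_deriv_L: "partial_deriv p (L $ i) = A i p"
  by (simp add: L partial_deriv_sum partial_deriv_mult partial_deriv_Var if_distrib
      cong: if_cong)

lemma partial_deriv_H: "partial_deriv p (H $ i) = 3 * (L $ i)\<^sup>2 * A i p"
  by (simp add: H power3_eq_cube power2_eq_square partial_deriv_mult partial_deriv_L
      algebra_simps)

lemma partial_deriv_M: "partial_deriv p (M i) = 3 * N i p"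
  by (simp add: M_def N_def partial_deriv_sum partial_deriv_mult partial_deriv_H
      sum_distrib_left mult_ac)

lemma sum_A_Var: "(\<Sum>p\<in>UNIV. A i p * Var p) = L $ i"
  by (simp add: L)

lemma sum_A_H: "(\<Sum>p\<in>UNIV. A i p * H $ p) = M i"
  by (simp add: M_def)

lemma sum_N_mult:
  "(\<Sum>p\<in>UNIV. N i p * f p) = (\<Sum>j\<in>UNIV. A i j * (L $ j)\<^sup>2 * (\<Sum>p\<in>UNIV. A j p * f p))"
  unfolding N_def sum_distrib_right sum_distrib_left
  by (subst sum.swap) (simp add: mult_ac)

text \<open>Euler's identity for the cubic forms \<open>M i\<close>, whose derivatives are
  \<open>3 * N i p\<close>.\<close>

lemma sum_N_Var: "(\<Sum>p\<in>UNIV. N i p * Var p) = M i"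
  unfolding sum_N_mult sum_A_Var M_def
  by (simp add: H power3_eq_cube power2_eq_square mult_ac)

lemma sum_N_H: "(\<Sum>p\<in>UNIV. N i p * H $ p) = (\<Sum>j\<in>UNIV. A i j * (L $ j)\<^sup>2 * M j)"
  by (simp add: sum_N_mult sum_A_H)

text \<open>If row \<open>i\<close> of \<open>a\<close> has a nonzero entry, it is a constant
  derivative of \<open>L_i\<close>, so \<open>L_i\<close> is no zero divisor and cancels twice. If
  the row is zero, so is \<open>L_i\<close>, but then the sum has zero coefficients.\<close>

lemma row_cancel:
  assumes "(L $ i)\<^sup>2 * (\<Sum>j\<in>UNIV. A i j * f j) = 0"
  shows "(\<Sum>j\<in>UNIV. A i j * f j) = 0"
proof (cases "\<exists>p. a $ i $ p \<noteq> 0")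
  case True
  then obtain p where "a $ i $ p \<noteq> 0" ..
  note cancel = mult_eq_0_if_const_deriv[OF partial_deriv_L this]
  show ?thesis
    by (rule cancel, rule cancel) (use assms in \<open>simp add: power2_eq_square mult.assoc\<close>)
next
  case False
  then show ?thesis by (simp add: Const_def)
qed

section \<open>Powers of the Jacobian matrix\<close>

lemma jacobian_matrix_H: "jacobian_matrix H $ i $ p = 3 * (L $ i)\<^sup>2 * A i p"
  by (simp add: jacobian_matrix_def partial_deriv_H)

lemma jacobian_square:
  "(jacobian_matrix H ** jacobian_matrix H) $ i $ p = 9 * ((L $ i)\<^sup>2 * N i p)"
  by (simp add: matrix_matrix_mult_def jacobian_matrix_H N_def sum_distrib_left mult_ac)

text \<open>Grouping the cube as \<open>JH\<close> times \<open>(JH)^2\<close> pulls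
  \<open>L_i^2\<close> out of row \<open>i\<close>, in the form that \<open>row_cancel\<close>
  needs.\<close>

lemma jacobian_cube:
  "(jacobian_matrix H ** jacobian_matrix H ** jacobian_matrix H) $ i $ p =
    27 * ((L $ i)\<^sup>2 * (\<Sum>j\<in>UNIV. A i j * ((L $ j)\<^sup>2 * N j p)))"
proof -
  have "(jacobian_matrix H ** jacobian_matrix H ** jacobian_matrix H) $ i $ p =
      (\<Sum>j\<in>UNIV. jacobian_matrix H $ i $ j * (jacobian_matrix H ** jacobian_matrix H) $ j $ p)"
    unfolding matrix_mul_assoc[symmetric]
    by (subst matrix_matrix_mult_def) simp
  also have "\<dots> = (\<Sum>j\<in>UNIV. 27 * ((L $ i)\<^sup>2 * (A i j * ((L $ j)\<^sup>2 * N j p))))"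
    unfolding jacobian_matrix_H jacobian_square by (intro sum.cong refl) simp
  finally show ?thesis
    by (simp only: sum_distrib_left)
qed

lemma N_eq_0:
  assumes "jacobian_matrix H ** jacobian_matrix H = 0"
  shows "N i p = 0"
proof -
  have "9 * ((L $ i)\<^sup>2 * N i p) = 0"
    using assms by (simp flip: jacobian_square)
  then have "(L $ i)\<^sup>2 * N i p = 0"
    by (simp only: numeral_mult_eq_0_iff)
  then show ?thesis
    using row_cancel[of i "\<lambda>j. (L $ j)\<^sup>2 * A j p"] by (simp add: N_def mult.assoc)
qed

text \<open>Solves \<open>Y = X + L(X)^3\<close> for \<open>X\<close>: once \<open>M\<close> is
  invariant under \<open>F\<close>, \<open>L(X) = L(Y) - M(Y)\<close>.\<close>

definition G :: "('a, 'n) poly_map"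
  where "G = (\<chi> i. Var i - (L $ i - M i) ^ 3)"

section \<open>Niceness, inverse and degree bound from three relations\<close>

context
  assumes LLM: "\<And>i. (\<Sum>j\<in>UNIV. A i j * ((L $ j)\<^sup>2 * M j)) = 0"
    and LMM: "\<And>i. (\<Sum>j\<in>UNIV. A i j * (L $ j * (M j)\<^sup>2)) = 0"
    and MMM: "\<And>i. (\<Sum>j\<in>UNIV. A i j * M j ^ 3) = 0"
begin

text \<open>The three relations annihilate every term of the expansion but \<open>L^3\<close>. Hence
  the shift of \<open>L\<close> to \<open>L + M\<close> that \<open>F\<close> induces leaves
  \<open>M\<close> fixed.\<close>

lemma sum_A_cube_add: "(\<Sum>j\<in>UNIV. A i j * (L $ j + M j) ^ 3) = M i"
proof -
  have "(\<Sum>j\<in>UNIV. A i j * (L $ j + M j) ^ 3) =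
      (\<Sum>j\<in>UNIV. A i j * H $ j + 3 * (A i j * ((L $ j)\<^sup>2 * M j)) +
        3 * (A i j * (L $ j * (M j)\<^sup>2)) + A i j * M j ^ 3)"
    by (intro sum.cong refl) (simp add: H power3_eq_cube power2_eq_square algebra_simps)
  also have "\<dots> = M i"
    unfolding sum.distrib sum_distrib_left[symmetric] LLM LMM MMM by (simp add: M_def)
  finally show ?thesis .
qed

lemma sum_A_cube_diff: "(\<Sum>j\<in>UNIV. A i j * (L $ j - M j) ^ 3) = M i"
proof -
  have "(\<Sum>j\<in>UNIV. A i j * (L $ j - M j) ^ 3) =
      (\<Sum>j\<in>UNIV. A i j * H $ j - 3 * (A i j * ((L $ j)\<^sup>2 * M j)) +
        3 * (A i j * (L $ j * (M j)\<^sup>2)) - A i j * M j ^ 3)"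
    by (intro sum.cong refl) (simp add: H power3_eq_cube power2_eq_square algebra_simps)
  also have "\<dots> = M i"
    unfolding sum.distrib sum_subtractf sum_distrib_left[symmetric] LLM LMM MMM
    by (simp add: M_def)
  finally show ?thesis .
qed

lemma poly_subst_F_L: "poly_subst F (L $ i) = L $ i + M i"
  by (simp add: L[of i] F M_def poly_subst_sum poly_subst_mult distrib_left sum.distrib)

lemma poly_subst_F_M: "poly_subst F (M i) = M i"
  by (subst M_def) (simp add: H poly_subst_sum poly_subst_mult poly_subst_power poly_subst_F_L
      sum_A_cube_add)

text \<open>Substituting \<open>F\<close> shifts \<open>L\<close> by the invariant step
  \<open>M\<close>, so each difference of \<open>P_1 = L^3\<close> lowers the degree in
  \<open>L\<close> by one: \<open>P_4 = 3! M^3\<close> and \<open>P_5 = 0\<close>.\<close>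

lemma nice_F: "nice F"
proof -
  note subst = poly_subst_diff poly_subst_add poly_subst_mult poly_subst_power
    poly_subst_numeral poly_subst_F_L poly_subst_F_M
  note ring = power3_eq_cube power2_eq_square algebra_simps
  have 1: "nice_seq F (Suc 0) i = (L $ i) ^ 3" for i
    by (simp add: F H)
  have 2: "nice_seq F (Suc (Suc 0)) i =
      3 * (L $ i)\<^sup>2 * M i + 3 * L $ i * (M i)\<^sup>2 + M i ^ 3" for i
    unfolding nice_seq.simps(2)[of F "Suc 0"] 1 subst by (simp add: ring)
  have 3: "nice_seq F (Suc (Suc (Suc 0))) i = 6 * L $ i * (M i)\<^sup>2 + 6 * M i ^ 3" for i
    unfolding nice_seq.simps(2)[of F "Suc (Suc 0)"] 2 subst by (simp add: ring)
  have 4: "nice_seq F (Suc (Suc (Suc (Suc 0)))) i = 6 * M i ^ 3" for i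
    unfolding nice_seq.simps(2)[of F "Suc (Suc (Suc 0))"] 3 subst by (simp add: ring)
  have "nice_seq F (Suc (Suc (Suc (Suc (Suc 0))))) i = 0" for i
    unfolding nice_seq.simps(2)[of F "Suc (Suc (Suc (Suc 0)))"] 4 subst by simp
  then show ?thesis unfolding nice_def by blast
qed

lemma poly_subst_G_L: "poly_subst G (L $ i) = L $ i - M i"
  by (simp add: L[of i] G_def poly_subst_sum poly_subst_mult right_diff_distrib sum_subtractf
      sum_A_cube_diff)

text \<open>\<open>G\<close> sends \<open>L\<close> to \<open>L - M\<close> and \<open>F\<close>
  sends \<open>L - M\<close> back to \<open>L\<close>, so the cubes cancel in both
  composites.\<close>

lemma is_poly_map_inverse_F: "is_poly_map_inverse F G"
proof -
  have "poly_subst G (F $ i) = Var i" for i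
    by (simp add: F H poly_subst_add poly_subst_power poly_subst_G_L) (simp add: G_def)
  moreover have "poly_subst F (G $ i) = Var i" for i
    by (simp add: G_def poly_subst_diff poly_subst_power poly_subst_F_L poly_subst_F_M)
      (simp add: F H)
  ultimately show ?thesis
    by (simp add: is_poly_map_inverse_def poly_map_comp_def poly_map_id_def)
qed

lemma invertible_F: "poly_map_invertible F"
  using is_poly_map_inverse_F by (auto simp: poly_map_invertible_def)

lemma poly_map_inv_F: "poly_map_inv F $ i = Var i - (L $ i - M i) ^ 3"
  by (simp add: poly_map_inv_eqI[OF is_poly_map_inverse_F] G_def)

lemma total_degree_L: "total_degree (L $ i) \<le> 1"
  unfolding L
  using total_degree_mult[OF eq_refl[OF total_degree_Const] total_degree_Var]
  by (intro total_degree_sum) simp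

lemma total_degree_M: "total_degree (M i) \<le> 3"
  unfolding M_def H
  using total_degree_mult[OF eq_refl[OF total_degree_Const] total_degree_power[OF total_degree_L, where k = 3]]
  by (intro total_degree_sum) simp

lemma poly_map_degree_inv_F: "poly_map_degree (poly_map_inv F) \<le> 9"
proof -
  have "total_degree (poly_map_inv F $ i) \<le> 9" for i
  proof -
    have "total_degree (L $ i - M i) \<le> 3"
      using total_degree_L[of i] total_degree_M[of i] by (intro total_degree_diff) auto
    from total_degree_power[OF this, of 3] have "total_degree ((L $ i - M i) ^ 3) \<le> 9"
      by simp
    moreover have "total_degree (Var i :: ('a, 'n) mpoly) \<le> 9"
      using total_degree_Var[of i] by (rule order_trans) simp
    ultimately show ?thesis
      unfolding poly_map_inv_F by (intro total_degree_diff)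
  qed
  then show ?thesis by (auto simp: poly_map_degree_def)
qed

end

section \<open>The relations from nilpotency of the Jacobian matrix\<close>

lemma inverse_if_jacobian_square_eq_0:
  assumes "jacobian_matrix H ** jacobian_matrix H = 0"
  shows "nice F" "poly_map_invertible F" "poly_map_inv F $ i = Var i - H $ i"
proof -
  \<comment> \<open>By Euler's identity \<open>N = 0\<close> forces \<open>M = 0\<close>; the three
    relations become trivial and \<open>G\<close> becomes \<open>X - H\<close>.\<close>
  have M: "M i = 0" for i
    unfolding sum_N_Var[symmetric] by (simp add: N_eq_0[OF assms])
  have "(\<Sum>j\<in>UNIV. A i j * ((L $ j)\<^sup>2 * M j)) = 0"
    and "(\<Sum>j\<in>UNIV. A i j * (L $ j * (M j)\<^sup>2)) = 0"
    and "(\<Sum>j\<in>UNIV. A i j * M j ^ 3) = 0" for i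
    by (simp_all add: M)
  note rel = this
  show "nice F" "poly_map_invertible F"
    using nice_F[OF rel] invertible_F[OF rel] by auto
  show "poly_map_inv F $ i = Var i - H $ i"
    using poly_map_inv_F[OF rel] by (simp add: M H)
qed

lemma inverse_if_jacobian_cube_eq_0:
  assumes "jacobian_matrix H ** jacobian_matrix H ** jacobian_matrix H = 0"
  shows "nice F" "poly_map_invertible F" "poly_map_degree (poly_map_inv F) \<le> 9"
proof -
  have LLN: "(\<Sum>j\<in>UNIV. A i j * ((L $ j)\<^sup>2 * N j p)) = 0" for i p
  proof -
    have "27 * ((L $ i)\<^sup>2 * (\<Sum>j\<in>UNIV. A i j * ((L $ j)\<^sup>2 * N j p))) = 0"
      using assms by (simp flip: jacobian_cube)
    then show ?thesis
      by (intro row_cancel) (simp only: numeral_mult_eq_0_iff)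
  qed
  \<comment> \<open>Weighting by \<open>X\<close> undoes a derivative of a form up to a factor;
    weighting by \<open>H\<close> turns a factor \<open>A j p\<close> into
    \<open>M j\<close>.\<close>
  have contract: "(\<Sum>j\<in>UNIV. u j * (\<Sum>p\<in>UNIV. f j p * v p)) = 0"
    if "\<And>p. (\<Sum>j\<in>UNIV. u j * f j p) = 0"
    for u v :: "'n \<Rightarrow> ('a, 'n) mpoly" and f
  proof -
    have "(\<Sum>j\<in>UNIV. u j * (\<Sum>p\<in>UNIV. f j p * v p)) =
        (\<Sum>p\<in>UNIV. (\<Sum>j\<in>UNIV. u j * f j p) * v p)"
      unfolding sum_distrib_left sum_distrib_right by (subst sum.swap) (simp add: mult_ac)
    then show ?thesis by (simp add: that)
  qed
  have LLM: "(\<Sum>j\<in>UNIV. A i j * ((L $ j)\<^sup>2 * M j)) = 0" for i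
    using contract[of "\<lambda>j. A i j * (L $ j)\<^sup>2" N Var] LLN[of i]
    by (simp add: sum_N_Var mult.assoc)
  \<comment> \<open>In the derivative of \<open>LLM\<close>, the part in which \<open>M\<close> is
    differentiated vanishes by \<open>LLN\<close>.\<close>
  have LAM: "(\<Sum>j\<in>UNIV. A i j * (L $ j * M j) * A j p) = 0" for i p
  proof -
    have "0 = partial_deriv p (\<Sum>j\<in>UNIV. A i j * ((L $ j)\<^sup>2 * M j))"
      by (simp add: LLM)
    also have "\<dots> = (\<Sum>j\<in>UNIV. 2 * (A i j * (L $ j * M j) * A j p) +
        3 * (A i j * ((L $ j)\<^sup>2 * N j p)))"
      unfolding partial_deriv_sum
      by (intro sum.cong refl)
        (simp add: partial_deriv_mult partial_deriv_L partial_deriv_M power2_eq_square algebra_simps)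
    also have "\<dots> = 2 * (\<Sum>j\<in>UNIV. A i j * (L $ j * M j) * A j p)"
      unfolding sum.distrib sum_distrib_left[symmetric] LLN by simp
    finally have "2 * (\<Sum>j\<in>UNIV. A i j * (L $ j * M j) * A j p) = 0" ..
    then show ?thesis
      by (simp only: numeral_mult_eq_0_iff)
  qed
  have LMM: "(\<Sum>j\<in>UNIV. A i j * (L $ j * (M j)\<^sup>2)) = 0" for i
    using contract[of "\<lambda>j. A i j * (L $ j * M j)" A "\<lambda>p. H $ p", OF LAM]
    by (simp add: sum_A_H power2_eq_square mult.assoc)
  \<comment> \<open>A second derivative, now of \<open>LAM\<close>, leaves two free indices
    \<open>p\<close> and \<open>q\<close>, each to be contracted with \<open>H\<close>.\<close>
  have "(\<Sum>j\<in>UNIV. A i j * A j p * (A j q * M j + 3 * L $ j * N j q)) = 0" for i p q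
  proof -
    have "0 = partial_deriv q (\<Sum>j\<in>UNIV. A i j * (L $ j * M j) * A j p)"
      by (simp add: LAM)
    also have "\<dots> = (\<Sum>j\<in>UNIV. A i j * A j p * (A j q * M j + 3 * L $ j * N j q))"
      unfolding partial_deriv_sum
      by (intro sum.cong refl)
        (simp add: partial_deriv_mult partial_deriv_L partial_deriv_M algebra_simps)
    finally show ?thesis by simp
  qed
  then have "(\<Sum>j\<in>UNIV. A i j * A j p * (\<Sum>q\<in>UNIV. (A j q * M j + 3 * L $ j * N j q) * H $ q)) = 0"
    for i p
    by (rule contract)
  \<comment> \<open>The \<open>N\<close> part drops out, since \<open>N\<close> applied to
    \<open>H\<close> is the left side of \<open>LLM\<close>.\<close>
  moreover have "(\<Sum>q\<in>UNIV. (A j q * M j + 3 * L $ j * N j q) * H $ q) = (M j)\<^sup>2" for j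
  proof -
    have "(\<Sum>q\<in>UNIV. (A j q * M j + 3 * L $ j * N j q) * H $ q) =
        M j * (\<Sum>q\<in>UNIV. A j q * H $ q) + 3 * L $ j * (\<Sum>q\<in>UNIV. N j q * H $ q)"
      by (simp add: sum_distrib_left sum.distrib algebra_simps)
    then show ?thesis
      using LLM[of j] by (simp add: sum_A_H sum_N_H power2_eq_square mult.assoc)
  qed
  ultimately have "(\<Sum>j\<in>UNIV. A i j * A j p * (M j)\<^sup>2) = 0" for i p
    by simp
  then have "(\<Sum>j\<in>UNIV. A i j * (M j)\<^sup>2 * A j p) = 0" for i p
    by (simp only: mult.assoc mult.commute[of "(M _)\<^sup>2"])
  \<comment> \<open>Contracting the remaining index \<open>p\<close> with \<open>H\<close> supplies
    the third factor \<open>M j\<close>.\<close>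
  then have "(\<Sum>j\<in>UNIV. A i j * (M j)\<^sup>2 * (\<Sum>p\<in>UNIV. A j p * H $ p)) = 0" for i
    by (rule contract)
  then have MMM: "(\<Sum>j\<in>UNIV. A i j * M j ^ 3) = 0" for i
    by (simp add: sum_A_H power2_eq_square power3_eq_cube mult.assoc)
  show "nice F" "poly_map_invertible F" "poly_map_degree (poly_map_inv F) \<le> 9"
    using nice_F[OF LLM LMM MMM] invertible_F[OF LLM LMM MMM]
      poly_map_degree_inv_F[OF LLM LMM MMM] by auto
qed

end

theorem theorem15:
  fixes a :: "'a::field_char_0 ^ 'n::finite ^ 'n"
    and L H F :: "('a, 'n) poly_map"
  assumes L: "\<And>i. L $ i = (\<Sum>j\<in>UNIV. Const (a $ i $ j) * Var j)"
    and H: "\<And>i. H $ i = (L $ i) ^ 3"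
    and F: "\<And>i. F $ i = Var i + H $ i"
  shows "(jacobian_matrix H ** jacobian_matrix H = 0 \<longrightarrow>
            nice F \<and> poly_map_invertible F \<and> (\<forall>i. poly_map_inv F $ i = Var i - H $ i))
       \<and> (jacobian_matrix H ** jacobian_matrix H ** jacobian_matrix H = 0 \<longrightarrow>
            nice F \<and> poly_map_invertible F \<and> poly_map_degree (poly_map_inv F) \<le> 9)"
proof -
  interpret cubic_linear_map a L H F
    by unfold_locales (fact L H F)+
  show ?thesis
    by (intro conjI impI allI) (erule inverse_if_jacobian_square_eq_0 inverse_if_jacobian_cube_eq_0)+
qed

end
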